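(* Let $p$ and $q$ be primes with $p \equiv 3 \pmod 8$, $q \equiv 1 \pmod 8$, and $\left(\frac{p}{q}\right) = -1$. Then the torsion subgroups of $E^{+}_{pq}(\mathbb{Q}(i))$ and $E^{-}_{pq}(\mathbb{Q}(i))$, where $E^{+}_{pq}: Y^2 = X^3 + pqX$ and $E^{-}_{pq}: Y^2 = X^3 - pqX$, are both isomorphic to $\mathbb{Z}/2\mathbb{Z}$.
   Context: $\left(\frac{p}{q}\right)$ is the Legendre symbol; $E(\mathbb{Q}(i))$ denotes the group of $\mathbb{Q}(i)$-rational points of the elliptic curve $E$. *)

theory Defs
  imports Complex_Main "HOL-Algebra.Elementary_Groups" "HOL-Number_Theory.Quadratic_Reciprocity"
begin

definition QI :: "complex set" where
  "QI = {z. Re z \<in> \<rat> \<and> Im z \<in> \<rat>}"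

text \<open>Points of the curve Y^2 = X^3 + a X over Q(i); None is the point at infinity.\<close>
definition ec_points :: "complex \<Rightarrow> (complex \<times> complex) option set" where
  "ec_points a = insert None
     {Some (x, y) | x y. x \<in> QI \<and> y \<in> QI \<and> y^2 = x^3 + a * x}"

fun ec_add :: "complex \<Rightarrow> (complex \<times> complex) option \<Rightarrow> (complex \<times> complex) option
                  \<Rightarrow> (complex \<times> complex) option" where
  "ec_add a None Q = Q"
| "ec_add a (Some P) None = Some P"
| "ec_add a (Some (x1, y1)) (Some (x2, y2)) =
     (if x1 = x2 \<and> y1 = - y2 then None
      else let l = (if x1 = x2 then (3 * x1^2 + a) / (2 * y1) else (y2 - y1) / (x2 - x1));
               x3 = l^2 - x1 - x2;
               y3 = l * (x1 - x3) - y1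
           in Some (x3, y3))"

definition ec_group :: "complex \<Rightarrow> (complex \<times> complex) option monoid" where
  "ec_group a = \<lparr>carrier = ec_points a, monoid.mult = ec_add a, one = None\<rparr>"

definition ec_torsion :: "complex \<Rightarrow> (complex \<times> complex) option monoid" where
  "ec_torsion a = (ec_group a)\<lparr>carrier :=
     {P \<in> ec_points a. \<exists>n::nat. n > 0 \<and> P [^]\<^bsub>ec_group a\<^esub> n = \<one>\<^bsub>ec_group a\<^esub>}\<rparr>"

end

theory Submission
  imports Defs
begin

text \<open>
  Let \<open>v\<close> be the valuation of \<open>\<rat>(\<i>)\<close> at \<open>1 + \<i>\<close>, and let \<open>a \<equiv> \<plusminus>3\<close> modulo 8. The duplication formula
  \<open>x(2P) = (x\<^sup>2 - a)\<^sup>2 / (4 x (x\<^sup>2 + a))\<close> shows that \<open>v(x(2P)) = v(x) - 4\<close> as soon as \<open>v(x) < 0\<close>, and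
  that after at most two doublings a point with \<open>x \<noteq> 0\<close> satisfies \<open>v(x) < 0\<close>. Hence the points
  \<open>2\<^sup>j P\<close> are eventually pairwise distinct and \<open>P\<close> is not torsion, which leaves only the point at
  infinity and \<open>(0, 0)\<close>. The one fragment of associativity needed is \<open>2(P + Q) = (2P + Q) + Q\<close>, which
  makes the power \<open>2\<^sup>j\<close> in the sense of iterated addition of \<open>P\<close> agree with repeated doubling.
\<close>

section \<open>Doubling a sum on the curve\<close>

definition ec_neg :: "(complex \<times> complex) option \<Rightarrow> (complex \<times> complex) option" where
  "ec_neg = map_option (\<lambda>(x, y). (x, - y))"

lemma ec_neg_simps [simp]:
  "ec_neg None = None" "ec_neg (Some (x, y)) = Some (x, - y)"
  by (simp_all add: ec_neg_def)

lemma ec_neg_neg [simp]: "ec_neg (ec_neg P) = P"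
  by (cases P) auto

lemma ec_add_None_right [simp]: "ec_add a P None = P"
  by (cases P) auto

lemma ec_add_neg_right [simp]: "ec_add a P (ec_neg P) = None"
  by (cases P) auto

section \<open>Arithmetic of Q(i) and membership in the curve\<close>

lemma QI_0 [simp]: "0 \<in> QI"
  by (simp add: QI_def)

lemma QI_of_int [simp]: "of_int n \<in> QI"
  by (simp add: QI_def)

lemma QI_numeral [simp]: "numeral n \<in> QI"
  by (simp add: QI_def)

lemma QI_add [simp]: "x \<in> QI \<Longrightarrow> y \<in> QI \<Longrightarrow> x + y \<in> QI"
  by (auto simp: QI_def)

lemma QI_minus [simp]: "x \<in> QI \<Longrightarrow> - x \<in> QI"
  by (auto simp: QI_def)

lemma QI_diff [simp]: "x \<in> QI \<Longrightarrow> y \<in> QI \<Longrightarrow> x - y \<in> QI"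
  by (auto simp: QI_def)

lemma QI_mult [simp]: "x \<in> QI \<Longrightarrow> y \<in> QI \<Longrightarrow> x * y \<in> QI"
  by (auto simp: QI_def)

lemma QI_power [simp]: "x \<in> QI \<Longrightarrow> x ^ n \<in> QI"
  by (induction n) (auto simp: QI_def)

lemma QI_divide [simp]: "x \<in> QI \<Longrightarrow> y \<in> QI \<Longrightarrow> x / y \<in> QI"
  by (auto simp: QI_def Re_divide Im_divide)

lemma ec_points_simps [simp]:
  "None \<in> ec_points a"
  "Some (x, y) \<in> ec_points a \<longleftrightarrow> x \<in> QI \<and> y \<in> QI \<and> y\<^sup>2 = x ^ 3 + a * x"
  by (auto simp: ec_points_def)

lemma ec_neg_closed [simp]: "P \<in> ec_points a \<Longrightarrow> ec_neg P \<in> ec_points a"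
  by (cases P) auto

section \<open>Commutativity, negation, closure and cancellation\<close>

lemma ec_add_commute:
  assumes "P \<in> ec_points a" "Q \<in> ec_points a"
  shows "ec_add a P Q = ec_add a Q P"
proof (cases "P = None \<or> Q = None")
  case True
  then show ?thesis by auto
next
  case False
  then obtain x1 y1 x2 y2 where eq: "P = Some (x1, y1)" "Q = Some (x2, y2)"
    by auto
  show ?thesis
  proof (cases "x1 = x2")
    case True
    with assms have "y1\<^sup>2 = y2\<^sup>2" by (simp add: eq)
    then have "y1 = y2 \<or> y1 = - y2" by (simp add: power2_eq_iff)
    with True show ?thesis by (auto simp: eq)
  next
    case False
    have l: "(y1 - y2) / (x1 - x2) = (y2 - y1) / (x2 - x1)"
      by (metis minus_diff_eq minus_divide_divide)
    define m where "m = (y2 - y1) / (x2 - x1)"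
    have "m * (x2 - x1) = y2 - y1"
      using False by (simp add: m_def)
    then show ?thesis using False
      by (simp add: eq Let_def l flip: m_def) (auto simp: algebra_simps)
  qed
qed

lemma ec_neg_add: "ec_neg (ec_add a P Q) = ec_add a (ec_neg P) (ec_neg Q)"
proof (cases "P = None \<or> Q = None")
  case True
  then show ?thesis by auto
next
  case False
  then obtain x1 y1 x2 y2 where eq: "P = Some (x1, y1)" "Q = Some (x2, y2)"
    by auto
  have "(- y2 - - y1) / (x2 - x1) = - ((y2 - y1) / (x2 - x1))"
    by (metis minus_diff_minus minus_divide_left)
  then show ?thesis
    by (auto simp: eq Let_def algebra_simps)
qed

text \<open>Subtracting the two curve equations and dividing by \<open>x2 - x1\<close> leaves a
  relation for the slope without denominators. It degenerates to the tangent equation when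
  \<open>x2 = x1\<close>, and it is what the later Groebner basis computations take as
  input.\<close>

lemma chord_tangent_slope:
  fixes a :: complex
  assumes P: "y1\<^sup>2 = x1 ^ 3 + a * x1" and Q: "y2\<^sup>2 = x2 ^ 3 + a * x2" 
    and "x1 \<noteq> x2" and l: "l = (y2 - y1) / (x2 - x1)"
  shows "l * (x2 - x1) = y2 - y1"
    and "2 * y1 * l = (x2 - x1) ^ 2 + 3 * x1 * (x2 - x1) + 3 * x1 ^ 2 + a - l ^ 2 * (x2 - x1)"
proof -
  show 1: "l * (x2 - x1) = y2 - y1"
    using assms(3) by (simp add: l)
  have y2: "y2 = y1 + l * (x2 - x1)" using 1 by simp
  have "(x2 - x1) * (2 * y1 * l) = (x2 - x1) *
     ((x2 - x1) ^ 2 + 3 * x1 * (x2 - x1) + 3 * x1 ^ 2 + a - l ^ 2 * (x2 - x1))"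
    using P Q unfolding y2 by Groebner_Basis.algebra
  then show "2 * y1 * l = (x2 - x1) ^ 2 + 3 * x1 * (x2 - x1) + 3 * x1 ^ 2 + a - l ^ 2 * (x2 - x1)"
    using assms(3) by simp
qed

text \<open>Substituting the line into the cubic gives roots with sum \<open>l^2\<close>, so the
  third intersection point has abscissa \<open>l^2 - x1 - x2\<close>; this is checked as a
  polynomial identity.\<close>

lemma ec_add_closed:
  assumes "a \<in> QI" "P \<in> ec_points a" "Q \<in> ec_points a"
  shows "ec_add a P Q \<in> ec_points a"
proof (cases "P = None \<or> Q = None")
  case True
  then show ?thesis using assms by auto
next
  case False
  then obtain x1 y1 x2 y2 where eq: "P = Some (x1, y1)" "Q = Some (x2, y2)"
    by auto
  show ?thesis
  proof (cases "x1 = x2")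
    case True
    with assms have "y1\<^sup>2 = y2\<^sup>2" by (simp add: eq)
    then consider "y1 = - y2" | "y1 = y2" "y1 \<noteq> 0" by (force simp: power2_eq_iff)
    then show ?thesis
    proof cases
      case 1
      then show ?thesis using True by (simp add: eq)
    next
      case 2
      define m where "m = (3 * x1\<^sup>2 + a) / (2 * y1)"
      have m: "m * (2 * y1) = 3 * x1\<^sup>2 + a"
        using 2 by (simp add: m_def)
      define z where "z = m\<^sup>2 - x1 - x1"
      have y: "y1\<^sup>2 = x1 ^ 3 + a * x1" using assms by (simp add: eq)
      have "(m * (x1 - z) - y1)\<^sup>2 = z ^ 3 + a * z"
        using m y unfolding z_def by Groebner_Basis.algebra
      then show ?thesis using True 2 assms
        by (simp add: eq Let_def flip: m_def z_def)
           (simp add: m_def z_def)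
    qed
  next
    case False
    define l where "l = (y2 - y1) / (x2 - x1)"
    define z where "z = l\<^sup>2 - x1 - x2"
    have P: "y1\<^sup>2 = x1 ^ 3 + a * x1" and Q: "y2\<^sup>2 = x2 ^ 3 + a * x2"
      using assms by (simp_all add: eq)
    note l = chord_tangent_slope[OF P Q False l_def]
    have "(l * (x1 - z) - y1)\<^sup>2 = z ^ 3 + a * z"
      using l(2) P unfolding z_def by Groebner_Basis.algebra
    then show ?thesis using False assms
      by (simp add: eq Let_def flip: l_def z_def)
         (simp add: l_def z_def)
  qed
qed

text \<open>Reflecting the line through \<open>P\<close> and \<open>Q\<close> in the horizontal axis
  gives a line through \<open>P + Q\<close>, \<open>-Q\<close> and \<open>-P\<close>. Hence the
  second addition uses slope \<open>-l\<close>, or \<open>-m\<close> in the tangent case, and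
  returns \<open>P\<close>.\<close>

lemma ec_add_diff_cancel:
  assumes "a \<noteq> 0" "P \<in> ec_points a" "Q \<in> ec_points a"
  shows "ec_add a (ec_add a P Q) (ec_neg Q) = P"
proof (cases "P = None \<or> Q = None")
  case True
  then show ?thesis using ec_add_neg_right[of a Q] by auto
next
  case False
  then obtain x1 y1 x2 y2 where eq: "P = Some (x1, y1)" "Q = Some (x2, y2)"
    by auto
  have P: "y1\<^sup>2 = x1 ^ 3 + a * x1" and Q: "y2\<^sup>2 = x2 ^ 3 + a * x2"
    using assms by (simp_all add: eq)
  show ?thesis
  proof (cases "x1 = x2")
    case True
    with P Q have "y1\<^sup>2 = y2\<^sup>2" by simp
    then consider "y1 = - y2" | "y1 = y2" "y1 \<noteq> 0" by (force simp: power2_eq_iff)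
    then show ?thesis
    proof cases
      case 1
      then show ?thesis using True by (simp add: eq)
    next
      case 2
      define m where "m = (3 * x1\<^sup>2 + a) / (2 * y1)"
      define z where "z = m\<^sup>2 - x1 - x1"
      define w where "w = m * (x1 - z) - y1"
      have PQ: "ec_add a P Q = Some (z, w)"
        using True 2 by (simp add: eq Let_def w_def z_def m_def)
      show ?thesis
      proof (cases "z = x1")
        \<comment> \<open>Here \<open>P\<close> is a flex with \<open>2P = -P\<close>, so the second
          addition is again a doubling.\<close>
        case z: True
        then have "w = - y1" by (simp add: w_def)
        moreover have "(3 * x1\<^sup>2 + a) / (2 * - y1) = - m"
          by (simp add: m_def)
        ultimately show ?thesis using 2 True z
          unfolding PQ by (simp add: eq Let_def) (simp add: z_def)
      next
        case z: False
        then have "(- y1 - w) / (x1 - z) = - m"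
          by (simp add: w_def field_simps)
        then show ?thesis using 2 True z
          unfolding PQ by (simp add: eq Let_def) (auto simp: z_def w_def algebra_simps)
      qed
    qed
  next
    case False
    define l where "l = (y2 - y1) / (x2 - x1)"
    define z where "z = l\<^sup>2 - x1 - x2"
    define w where "w = l * (x1 - z) - y1"
    have PQ: "ec_add a P Q = Some (z, w)"
      using False by (simp add: eq Let_def w_def z_def l_def)
    have l: "l = (y1 - y2) / (x1 - x2)"
      unfolding l_def by (metis minus_diff_eq minus_divide_divide)
    note l' = chord_tangent_slope[OF Q P False[symmetric] l]
    have w2: "w = l * (x2 - z) - y2"
      using l'(1) by (simp add: w_def algebra_simps)
    show ?thesis
    proof (cases "z = x2")
      \<comment> \<open>The chord is tangent at \<open>Q\<close> and \<open>P + Q = -Q\<close>, so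
        the second addition uses the tangent formula at \<open>-Q\<close>.\<close>
      case z: True
      then have w: "w = - y2" by (simp add: w2)
      have t: "2 * y2 * l = 3 * x2\<^sup>2 + a"
        using l'(2) z unfolding z_def by Groebner_Basis.algebra
      \<comment> \<open>Otherwise \<open>Q\<close> would be a singular point of the curve, which
        \<open>a \<noteq> 0\<close> rules out.\<close>
      have "y2 \<noteq> 0"
      proof
        assume "y2 = 0"
        have "3 * x2\<^sup>2 + a = 0"
          using t \<open>y2 = 0\<close> by (metis mult_zero_left mult_zero_right)
        moreover have "x2 ^ 3 + a * x2 = 0"
          using Q \<open>y2 = 0\<close> by simp
        ultimately have "x2 * x2\<^sup>2 = 0" "3 * x2\<^sup>2 + a = 0" by Groebner_Basis.algebra+
        with \<open>a \<noteq> 0\<close> show False by simp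
      qed
      then have "(3 * x2\<^sup>2 + a) / (2 * - y2) = - l"
        by (simp add: t[symmetric])
      then show ?thesis using z w \<open>y2 \<noteq> 0\<close> l'(1)
        unfolding PQ by (simp add: eq Let_def) (auto simp: z_def algebra_simps)
    next
      case z: False
      then have "(- y2 - w) / (x2 - z) = - l"
        by (simp add: w2 field_simps)
      then show ?thesis using z
        unfolding PQ by (simp add: eq Let_def) (auto simp: z_def w_def algebra_simps)
    qed
  qed
qed

section \<open>The fragment of associativity for doubling\<close>

text \<open>Cases where a sum is not given by a chord of distinct abscissas, apart from the doubling
  of \<open>P\<close>, reduce to cancellation. The rest is a comparison of two chords; excluding
  \<open>Q = 2P\<close> keeps the sum of \<open>2P\<close> and \<open>Q\<close> from being a second
  doubling.\<close>

lemma ec_add_double_left_generic: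
  assumes a: "a \<in> QI" "a \<noteq> 0" and P: "P \<in> ec_points a" and Q: "Q \<in> ec_points a"
    and "Q \<noteq> ec_add a P P"
  shows "ec_add a P (ec_add a P Q) = ec_add a (ec_add a P P) Q"
proof -
  define C where "C = ec_add a P Q"
  define D where "D = ec_add a P P"
  note closed = ec_add_closed[OF a(1)]
  note cancel = ec_add_diff_cancel[OF a(2)]
  have C: "C \<in> ec_points a" and D: "D \<in> ec_points a"
    using closed P Q by (simp_all add: C_def D_def)
  have Q_eq: "ec_add a C (ec_neg P) = Q"
    using cancel[OF Q P] ec_add_commute[OF P Q] by (simp add: C_def)
  have D_diff: "ec_add a D (ec_neg P) = P"
    using cancel[OF P P] by (simp add: D_def)
  consider "P = None \<or> Q = None" | "Q = P" | "Q = ec_neg P" | "ec_neg P = P" | "C = P"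
    | "C = ec_neg P"
    | "P \<noteq> None" "Q \<noteq> None" "Q \<noteq> P" "Q \<noteq> ec_neg P" "ec_neg P \<noteq> P" "C \<noteq> P" "C \<noteq> ec_neg P"
    by blast
  then show ?thesis
  proof cases
    case 1
    then show ?thesis by auto
  next
    case 2
    then show ?thesis using ec_add_commute[OF P D] by (simp add: D_def)
  next
    case 3
    then show ?thesis using D_diff by (simp add: D_def)
  next
    case 4
    have "ec_add a P C = Q"
      using Q_eq ec_add_commute[OF P C] 4 by simp
    moreover have "D = None" using ec_add_neg_right[of a P] 4 by (simp add: D_def)
    ultimately show ?thesis by (simp add: C_def D_def)
  next
    case 5
    then have "Q = None" using Q_eq by simp
    then show ?thesis by simp
  next
    case 6
    then have "Q = ec_neg D"
      using Q_eq by (simp add: D_def ec_neg_add)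
    then have "ec_add a D Q = None" by simp
    moreover have "ec_add a P C = None" using 6 by simp
    ultimately show ?thesis by (simp add: C_def D_def)
  next
    case 7
    obtain x1 y1 x2 y2 where eq: "P = Some (x1, y1)" "Q = Some (x2, y2)"
      using 7 by auto
    have P': "y1\<^sup>2 = x1 ^ 3 + a * x1" and Q': "y2\<^sup>2 = x2 ^ 3 + a * x2"
      using P Q by (simp_all add: eq)
    have x12: "x1 \<noteq> x2"
    proof
      assume "x1 = x2"
      with P' Q' have "y2\<^sup>2 = y1\<^sup>2" by simp
      then have "y2 = y1 \<or> y2 = - y1" by (simp add: power2_eq_iff)
      with \<open>x1 = x2\<close> 7 show False by (auto simp: eq)
    qed
    have y1: "y1 \<noteq> 0" using 7 by (auto simp: eq)
    define l where "l = (y2 - y1) / (x2 - x1)"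
    define x3 where "x3 = l\<^sup>2 - x1 - x2"
    define y3 where "y3 = l * (x1 - x3) - y1"
    define m where "m = (3 * x1\<^sup>2 + a) / (2 * y1)"
    define x4 where "x4 = m\<^sup>2 - x1 - x1"
    define y4 where "y4 = m * (x1 - x4) - y1"
    have C_eq: "C = Some (x3, y3)"
      using x12 by (simp add: C_def eq Let_def x3_def y3_def l_def)
    have D_eq: "D = Some (x4, y4)"
      using y1 by (simp add: D_def eq Let_def x4_def y4_def m_def)
    have m: "m * (2 * y1) = 3 * x1\<^sup>2 + a" using y1 by (simp add: m_def)
    note l = chord_tangent_slope[OF P' Q' x12 l_def]
    have x13: "x1 \<noteq> x3"
    proof
      assume "x1 = x3"
      then have "y3\<^sup>2 = y1\<^sup>2" using P' C by (simp add: C_eq)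
      then have "y3 = y1 \<or> y3 = - y1" by (simp add: power2_eq_iff)
      with \<open>x1 = x3\<close> 7 show False by (auto simp: eq C_eq)
    qed
    \<comment> \<open>Comparison of the chord relation with the tangent equation at
      \<open>P\<close>: the chord has the tangent slope only if it meets \<open>P\<close> twice.
      This supplies the nonzero denominator \<open>l - m\<close> below.\<close>
    have ld: "2 * y1 * (l - m) = - ((x2 - x1) * (x3 - x1))"
      using l(2) m unfolding x3_def by Groebner_Basis.algebra
    have "l \<noteq> m" using ld x12 x13 by auto
    have x24: "x4 \<noteq> x2"
    proof
      assume "x4 = x2"
      then have "y4\<^sup>2 = y2\<^sup>2" using Q' D by (simp add: D_eq)
      then have "y4 = y2 \<or> y4 = - y2" by (simp add: power2_eq_iff)
      with \<open>x4 = x2\<close> have "Q = D \<or> Q = ec_neg D" by (auto simp: eq D_eq)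
      with \<open>Q \<noteq> ec_add a P P\<close> have "Q = ec_neg D"
        by (simp add: D_def)
      then have "ec_neg C = ec_add a D (ec_neg P)"
        using ec_neg_add[of a P Q] ec_add_commute[OF D, of "ec_neg P"] P by (simp add: C_def)
      then have "C = ec_neg P" using D_diff by (metis ec_neg_neg)
      with 7 show False by simp
    qed
    \<comment> \<open>The lines through \<open>P, C\<close> and through \<open>D, Q\<close> turn out to have slopes \<open>k - l\<close> and \<open>k - m\<close>.\<close>
    define k where "k = (x2 - x1) / (l - m)"
    have k: "k * (l - m) = x2 - x1" using \<open>l \<noteq> m\<close> by (simp add: k_def)
    have "(l - m) * (k * (x3 - x1)) = (l - m) * (- (2 * y1))"
      using ld k by Groebner_Basis.algebra
    then have k': "k * (x3 - x1) = - (2 * y1)"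
      using \<open>l \<noteq> m\<close> by (metis mult_left_cancel right_minus_eq)
    have "y3 - y1 = (k - l) * (x3 - x1)"
      using k' unfolding y3_def by Groebner_Basis.algebra
    then have s: "(y3 - y1) / (x3 - x1) = k - l"
      using x13 by simp
    have y24: "y2 - y4 = (k - m) * (x2 - x4)"
      using k' k l(1) unfolding y4_def x4_def x3_def by Groebner_Basis.algebra
    with x24 have r: "(y2 - y4) / (x2 - x4) = k - m"
      by simp
    define x5 where "x5 = (k - l)\<^sup>2 - x1 - x3"
    have x5: "x5 = (k - m)\<^sup>2 - x4 - x2"
      using k unfolding x5_def x3_def x4_def by Groebner_Basis.algebra
    have "(k - l) * (x1 - x5) - y1 = (k - m) * (x2 - x5) - y2"
      using k l(1) unfolding x5_def x3_def by Groebner_Basis.algebra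
    also have "\<dots> = (k - m) * (x4 - x5) - y4"
      using y24 by Groebner_Basis.algebra
    finally have y5: "(k - l) * (x1 - x5) - y1 = (k - m) * (x4 - x5) - y4" .
    have "ec_add a P C = Some (x5, (k - l) * (x1 - x5) - y1)"
      using x13 by (simp add: eq C_eq s Let_def x5_def)
    moreover have "ec_add a D Q = Some (x5, (k - m) * (x4 - x5) - y4)"
      using x24 by (simp add: eq D_eq r Let_def x5)
    ultimately show ?thesis by (simp add: y5 flip: C_def D_def)
  qed
qed

lemma ec_add_double_left:
  assumes a: "a \<in> QI" "a \<noteq> 0" and P: "P \<in> ec_points a" and Q: "Q \<in> ec_points a"
  shows "ec_add a P (ec_add a P Q) = ec_add a (ec_add a P P) Q"
proof (cases "Q = ec_add a P P")
  case True
  \<comment> \<open>Apply the generic case to \<open>D = 2P\<close> and \<open>-P\<close> instead, and add \<open>P\<close>.\<close>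
  define D where "D = ec_add a P P"
  note closed = ec_add_closed[OF a(1)]
  note cancel = ec_add_diff_cancel[OF a(2)]
  have D: "D \<in> ec_points a"
    using closed P by (simp add: D_def)
  have D_diff: "ec_add a D (ec_neg P) = P"
    using cancel[OF P P] by (simp add: D_def)
  have "ec_add a P (ec_add a P D) = ec_add a D D"
  \<comment> \<open>The generic case for \<open>D\<close> and \<open>-P\<close> excludes exactly
    \<open>-P = 2D\<close>. There cancellation gives \<open>D = -P - D\<close>, that is
    \<open>P + D = -D\<close>, and the claim follows directly.\<close>
  proof (cases "ec_neg P = ec_add a D D")
    case True
    then have "D = ec_add a (ec_neg P) (ec_neg D)"
      using cancel[OF D D] by simp
    then have "ec_add a P D = ec_neg D"
      by (metis ec_neg_add ec_neg_neg)
    then have "ec_add a P (ec_add a P D) = ec_neg (ec_add a (ec_neg P) D)"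
      by (simp add: ec_neg_add)
    also have "ec_add a (ec_neg P) D = P"
      using D_diff ec_add_commute[OF D, of "ec_neg P"] P by simp
    finally show ?thesis using True by simp
  next
    case False
    have "ec_add a P (ec_add a P D) = ec_add a (ec_add a D P) P"
      using ec_add_commute P D closed by simp
    also have "ec_add a D P = ec_add a (ec_add a D D) (ec_neg P)"
      using ec_add_double_left_generic[OF a D _ False] P D_diff by simp
    also have "ec_add a \<dots> P = ec_add a D D"
      using cancel[of "ec_add a D D" "ec_neg P"] D P closed by simp
    finally show ?thesis .
  qed
  then show ?thesis using True by (simp add: D_def)
qed (use ec_add_double_left_generic assms in blast)

text \<open>This is the induction step for \<open>ec_pow_double\<close>, since powers add one point
  at a time on the right. With \<open>C = P + Q\<close> the right side is rebracketed by
  \<open>ec_add_double_left\<close> alone: it becomes \<open>2P + 2Q\<close>, then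
  \<open>P + (C + Q)\<close>, and \<open>Q = C - P\<close> turns this into
  \<open>P + (2C - P) = 2C\<close>.\<close>

lemma ec_add_double_sum:
  assumes a: "a \<in> QI" "a \<noteq> 0" and P: "P \<in> ec_points a" and Q: "Q \<in> ec_points a"
  shows "ec_add a (ec_add a P Q) (ec_add a P Q) = ec_add a (ec_add a (ec_add a P P) Q) Q"
proof -
  note closed = ec_add_closed[OF a(1)]
  note cancel = ec_add_diff_cancel[OF a(2)]
  note double = ec_add_double_left[OF a]
  define C where "C = ec_add a P Q"
  define D where "D = ec_add a C C"
  have C: "C \<in> ec_points a" and D: "D \<in> ec_points a"
    using closed P Q by (simp_all add: C_def D_def)
  have C_diff: "ec_add a C (ec_neg P) = Q"
    using cancel[OF Q P] ec_add_commute[OF P Q] by (simp add: C_def)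
  have "ec_add a (ec_add a (ec_add a P P) Q) Q = ec_add a Q (ec_add a Q (ec_add a P P))"
    using ec_add_commute P Q closed by simp
  also have "\<dots> = ec_add a (ec_add a P P) (ec_add a Q Q)"
    using double[OF Q, of "ec_add a P P"] P Q closed
      ec_add_commute[of "ec_add a P P" a "ec_add a Q Q"] by simp
  also have "\<dots> = ec_add a P (ec_add a P (ec_add a Q Q))"
    using double[OF P] Q closed by simp
  also have "ec_add a P (ec_add a Q Q) = ec_add a Q (ec_add a Q P)"
    using double[OF Q P] ec_add_commute P Q closed by simp
  also have "\<dots> = ec_add a C Q"
    using ec_add_commute P Q C closed by (simp add: C_def)
  also have "\<dots> = ec_add a D (ec_neg P)"
    using double[OF C, of "ec_neg P"] P C_diff by (simp add: D_def)
  also have "ec_add a P \<dots> = ec_add a \<dots> P"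
    using ec_add_commute P D closed by simp
  also have "\<dots> = D"
    using cancel[OF D, of "ec_neg P"] P by simp
  finally show ?thesis by (simp add: D_def C_def)
qed

section \<open>Iterated addition, its doubling and its periodicity\<close>

lemma ec_group_simps [simp]:
  "carrier (ec_group a) = ec_points a"
  "x \<otimes>\<^bsub>ec_group a\<^esub> y = ec_add a x y"
  "\<one>\<^bsub>ec_group a\<^esub> = None"
  by (simp_all add: ec_group_def)

lemma ec_pow_0 [simp]: "P [^]\<^bsub>ec_group a\<^esub> (0::nat) = None"
  by (simp add: nat_pow_def)

lemma ec_pow_Suc [simp]:
  "P [^]\<^bsub>ec_group a\<^esub> (Suc n) = ec_add a (P [^]\<^bsub>ec_group a\<^esub> n) P"
  by (simp add: nat_pow_def)

lemma ec_pow_closed [simp]: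
  "a \<in> QI \<Longrightarrow> P \<in> ec_points a \<Longrightarrow> P [^]\<^bsub>ec_group a\<^esub> (n::nat) \<in> ec_points a"
  by (induction n) (auto intro: ec_add_closed)

lemma ec_pow_double:
  assumes "a \<in> QI" "a \<noteq> 0" "P \<in> ec_points a"
  shows "P [^]\<^bsub>ec_group a\<^esub> (2 * n :: nat) =
    ec_add a (P [^]\<^bsub>ec_group a\<^esub> n) (P [^]\<^bsub>ec_group a\<^esub> n)"
proof (induction n)
  case (Suc n)
  then show ?case
    using ec_add_double_sum[OF assms(1,2), of "P [^]\<^bsub>ec_group a\<^esub> n" P] assms
    by (simp del: ec_add.simps)
qed simp

text \<open>The powers are the iterates of one map, adding \<open>P\<close>, started at
  \<open>None\<close>; a return to \<open>None\<close> makes the sequence periodic.\<close>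

lemma ec_pow_mod:
  assumes "P [^]\<^bsub>ec_group a\<^esub> (n::nat) = None"
  shows "P [^]\<^bsub>ec_group a\<^esub> m = P [^]\<^bsub>ec_group a\<^esub> (m mod n)"
proof -
  have add: "P [^]\<^bsub>ec_group a\<^esub> (i + n) = P [^]\<^bsub>ec_group a\<^esub> i" for i
    using assms by (induction i) simp_all
  have "P [^]\<^bsub>ec_group a\<^esub> (k * n + i) = P [^]\<^bsub>ec_group a\<^esub> i" for k i
    by (induction k) (use add[of "_ * n + i"] in \<open>simp_all add: ac_simps\<close>)
  from this[of "m div n" "m mod n"] show ?thesis by simp
qed

section \<open>The valuation at the prime \<open>1 + \<i>\<close>\<close>

definition gauss_ints :: "complex set" where
  "gauss_ints = {z. Re z \<in> \<int> \<and> Im z \<in> \<int>}"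

text \<open>These are the Gaussian integers prime to \<open>1 + \<i>\<close>, because
  \<open>1 + \<i>\<close> divides \<open>c + d\<i>\<close> exactly when \<open>c + d\<close> is
  even.\<close>

definition gauss_odd :: "complex set" where
  "gauss_odd = {Complex (of_int c) (of_int d) | c d. odd (c + d)}"

definition gpi :: complex where
  "gpi = 1 + \<i>"

text \<open>The elements of valuation exactly \<open>k\<close>. As a family of sets it requires no
  value for 0, which belongs to none of them.\<close>

definition gauss_val :: "int \<Rightarrow> complex set" where
  "gauss_val k = {gpi powi k * (\<alpha> / \<beta>) | \<alpha> \<beta>. \<alpha> \<in> gauss_odd \<and> \<beta> \<in> gauss_odd}"

lemma gpi_nonzero [simp]: "gpi \<noteq> 0"
  by (simp add: gpi_def complex_eq_iff)

lemma gpi_ints [simp]: "gpi \<in> gauss_ints"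
  by (simp add: gpi_def gauss_ints_def)

lemma gauss_ints_closed [simp]:
  "x \<in> gauss_ints \<Longrightarrow> y \<in> gauss_ints \<Longrightarrow> x + y \<in> gauss_ints"
  "x \<in> gauss_ints \<Longrightarrow> y \<in> gauss_ints \<Longrightarrow> x - y \<in> gauss_ints"
  "x \<in> gauss_ints \<Longrightarrow> y \<in> gauss_ints \<Longrightarrow> x * y \<in> gauss_ints"
  "x \<in> gauss_ints \<Longrightarrow> - x \<in> gauss_ints"
  "of_int n \<in> gauss_ints" "1 \<in> gauss_ints" "numeral m \<in> gauss_ints" "\<i> \<in> gauss_ints"
  by (auto simp: gauss_ints_def)

lemma gauss_ints_power [simp]: "x \<in> gauss_ints \<Longrightarrow> x ^ n \<in> gauss_ints"
  by (induction n) auto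

lemma gauss_intsE:
  assumes "x \<in> gauss_ints"
  obtains c d where "x = Complex (of_int c) (of_int d)"
  using assms by (auto simp: gauss_ints_def complex_eq_iff elim!: Ints_cases)

lemma gauss_odd_ints [simp]: "x \<in> gauss_odd \<Longrightarrow> x \<in> gauss_ints"
  by (auto simp: gauss_odd_def gauss_ints_def)

lemma gauss_odd_nonzero [simp]: "0 \<notin> gauss_odd"
  by (auto simp: gauss_odd_def complex_eq_iff)

lemma gauss_odd_of_int [simp]: "of_int n \<in> gauss_odd \<longleftrightarrow> odd n"
  by (auto simp: gauss_odd_def complex_eq_iff)

lemma gauss_odd_1 [simp]: "1 \<in> gauss_odd"
  using gauss_odd_of_int[of 1] by simp

lemma gauss_odd_mult [simp]:
  assumes "x \<in> gauss_odd" "y \<in> gauss_odd"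
  shows "x * y \<in> gauss_odd"
proof -
  obtain c d e f where x: "x = Complex (of_int c) (of_int d)" and "odd (c + d)"
    and y: "y = Complex (of_int e) (of_int f)" and "odd (e + f)"
    using assms by (auto simp: gauss_odd_def)
  then have "odd ((c * e - d * f) + (c * f + d * e))"
    by auto
  moreover have "x * y = Complex (of_int (c * e - d * f)) (of_int (c * f + d * e))"
    by (simp add: x y complex_eq_iff)
  ultimately show ?thesis unfolding gauss_odd_def by blast
qed

lemma gauss_odd_add [simp]:
  assumes "x \<in> gauss_odd" "y \<in> gauss_ints"
  shows "x + gpi * y \<in> gauss_odd"
proof -
  obtain c d where x: "x = Complex (of_int c) (of_int d)" and "odd (c + d)"
    using assms by (auto simp: gauss_odd_def)
  moreover obtain e f where y: "y = Complex (of_int e) (of_int f)"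
    using assms by (auto elim: gauss_intsE)
  ultimately have "odd ((c + e - f) + (d + e + f))"
    by simp
  moreover have "x + gpi * y = Complex (of_int (c + e - f)) (of_int (d + e + f))"
    by (simp add: x y gpi_def complex_eq_iff)
  ultimately show ?thesis unfolding gauss_odd_def by blast
qed

lemma gauss_valE:
  assumes "x \<in> gauss_val k"
  obtains \<alpha> \<beta> where "\<alpha> \<in> gauss_odd" "\<beta> \<in> gauss_odd" "x = gpi powi k * (\<alpha> / \<beta>)"
  using assms by (auto simp: gauss_val_def)

lemma gauss_valI:
  "\<alpha> \<in> gauss_odd \<Longrightarrow> \<beta> \<in> gauss_odd \<Longrightarrow> x = gpi powi k * (\<alpha> / \<beta>) \<Longrightarrow> x \<in> gauss_val k"
  by (auto simp: gauss_val_def)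

lemma gauss_val_nonzero [simp]: "0 \<notin> gauss_val k"
  by (auto elim!: gauss_valE)

lemma gauss_val_gpi_power:
  assumes "\<alpha> \<in> gauss_odd"
  shows "gpi ^ n * \<alpha> \<in> gauss_val (int n)"
  by (rule gauss_valI[OF assms gauss_odd_1]) simp

lemma gauss_val_odd: "\<alpha> \<in> gauss_odd \<Longrightarrow> \<alpha> \<in> gauss_val 0"
  using gauss_val_gpi_power[of \<alpha> 0] by simp

lemma gauss_val_mult:
  assumes "x \<in> gauss_val j" "y \<in> gauss_val k"
  shows "x * y \<in> gauss_val (j + k)"
proof -
  obtain \<alpha> \<beta> \<gamma> \<delta> where *: "\<alpha> \<in> gauss_odd" "\<beta> \<in> gauss_odd" "x = gpi powi j * (\<alpha> / \<beta>)"
     "\<gamma> \<in> gauss_odd" "\<delta> \<in> gauss_odd" "y = gpi powi k * (\<gamma> / \<delta>)"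
    using assms by (auto elim!: gauss_valE)
  show ?thesis
    by (rule gauss_valI[of "\<alpha> * \<gamma>" "\<beta> * \<delta>"]) (use * in \<open>simp_all add: power_int_add\<close>)
qed

lemma gauss_val_divide:
  assumes "x \<in> gauss_val j" "y \<in> gauss_val k"
  shows "x / y \<in> gauss_val (j - k)"
proof -
  obtain \<alpha> \<beta> \<gamma> \<delta> where *: "\<alpha> \<in> gauss_odd" "\<beta> \<in> gauss_odd" "x = gpi powi j * (\<alpha> / \<beta>)"
     "\<gamma> \<in> gauss_odd" "\<delta> \<in> gauss_odd" "y = gpi powi k * (\<gamma> / \<delta>)"
    using assms by (auto elim!: gauss_valE)
  show ?thesis
    by (rule gauss_valI[of "\<alpha> * \<delta>" "\<beta> * \<gamma>"])
       (use * in \<open>simp_all add: power_int_diff field_simps\<close>)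
qed

text \<open>The sharp ultrametric law: over a common denominator and with \<open>gpi powi j\<close>
  taken out, the numerator is odd plus a multiple of \<open>gpi\<close>.\<close>

lemma gauss_val_add_less:
  assumes "x \<in> gauss_val j" "y \<in> gauss_val k" "j < k"
  shows "x + y \<in> gauss_val j"
proof -
  obtain \<alpha> \<beta> \<gamma> \<delta> where *: "\<alpha> \<in> gauss_odd" "\<beta> \<in> gauss_odd" "x = gpi powi j * (\<alpha> / \<beta>)"
     "\<gamma> \<in> gauss_odd" "\<delta> \<in> gauss_odd" "y = gpi powi k * (\<gamma> / \<delta>)"
    using assms by (auto elim!: gauss_valE)
  define n where "n = nat (k - j - 1)"
  have "k = j + 1 + int n" using assms(3) by (simp add: n_def)
  then have k: "gpi powi k = gpi powi j * (gpi * gpi ^ n)"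
    by (simp add: power_int_add)
  have "\<alpha> * \<delta> + gpi * (gpi ^ n * \<beta> * \<gamma>) \<in> gauss_odd"
    using * by (intro gauss_odd_add) auto
  moreover have "\<beta> \<noteq> 0" "\<delta> \<noteq> 0" using * by auto
  then have "x + y = gpi powi j * ((\<alpha> * \<delta> + gpi * (gpi ^ n * \<beta> * \<gamma>)) / (\<beta> * \<delta>))"
    unfolding *(3,6) k by (simp add: add_frac_eq) (simp add: field_simps)
  ultimately show ?thesis
    using *(2,5) gauss_odd_mult gauss_valI by blast
qed

text \<open>Two different valuations of \<open>x\<close> would give \<open>x + (-x) = 0\<close> the
  smaller one.\<close>

lemma gauss_val_unique:
  assumes "x \<in> gauss_val j" "x \<in> gauss_val k"
  shows "j = k"
proof -
  have False if "x \<in> gauss_val j" "x \<in> gauss_val k" "j < k" for j k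
  proof -
    have "- x \<in> gauss_val k"
      using gauss_val_mult[OF gauss_val_odd that(2), of "- 1"] gauss_odd_of_int[of "- 1"]
      by simp
    with that have "x + - x \<in> gauss_val j" by (blast intro: gauss_val_add_less)
    then show False by simp
  qed
  with assms show ?thesis by (metis linorder_neqE)
qed

lemma gauss_even:
  assumes "even (c + d)"
  obtains e f where "c = e - f" "d = e + f"
    "Complex (of_int c) (of_int d) = gpi * Complex (of_int e) (of_int f)"
proof -
  \<comment> \<open>The coordinates of the quotient of \<open>c + d\<i>\<close> by
    \<open>1 + \<i>\<close>.\<close>
  define e f where "e = (c + d) div 2" and "f = (d - c) div 2"
  have "c + d = 2 * e" "d - c = 2 * f" using assms by (auto simp: e_def f_def)
  then have "c = e - f" "d = e + f" by auto
  then show ?thesis using that by (simp add: gpi_def complex_eq_iff)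
qed

text \<open>Descent on the norm: dividing an even Gaussian integer by \<open>gpi\<close> halves
  \<open>c^2 + d^2\<close>.\<close>

lemma gauss_ints_val:
  assumes "x \<in> gauss_ints" "x \<noteq> 0"
  shows "\<exists>n. x \<in> gauss_val (int n)"
proof -
  obtain c d where x: "x = Complex (of_int c) (of_int d)"
    using assms(1) by (rule gauss_intsE)
  have "\<exists>n. Complex (of_int c) (of_int d) \<in> gauss_val (int n)"
    if "c \<noteq> 0 \<or> d \<noteq> 0"
    using that
  proof (induction "nat (c\<^sup>2 + d\<^sup>2)" arbitrary: c d rule: less_induct)
    case less
    show ?case
    proof (cases "odd (c + d)")
      case True
      then have "Complex (of_int c) (of_int d) \<in> gauss_val (int 0)"
        by (auto intro: gauss_val_odd simp: gauss_odd_def)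
      then show ?thesis by blast
    next
      case False
      then obtain e f where c: "c = e - f" and d: "d = e + f"
        and eq: "Complex (of_int c) (of_int d) = gpi * Complex (of_int e) (of_int f)"
        using gauss_even by blast
      have nz: "e \<noteq> 0 \<or> f \<noteq> 0" using less.prems by (auto simp: c d)
      then have "e\<^sup>2 + f\<^sup>2 > 0" by (auto simp: sum_power2_gt_zero_iff)
      moreover have "c\<^sup>2 + d\<^sup>2 = 2 * (e\<^sup>2 + f\<^sup>2)"
        by (simp add: c d power2_eq_square algebra_simps)
      ultimately have "nat (e\<^sup>2 + f\<^sup>2) < nat (c\<^sup>2 + d\<^sup>2)" by simp
      from less.hyps[OF this nz] obtain n
        where n: "Complex (of_int e) (of_int f) \<in> gauss_val (int n)" ..
      have "Complex (of_int c) (of_int d) = gpi ^ 1 * 1 * Complex (of_int e) (of_int f)"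
        by (simp add: eq)
      also have "\<dots> \<in> gauss_val (int 1 + int n)"
        by (intro gauss_val_mult gauss_val_gpi_power n gauss_odd_1)
      finally show ?thesis by (metis of_nat_add)
    qed
  qed
  moreover have "c \<noteq> 0 \<or> d \<noteq> 0"
    using assms(2) x by (auto simp: complex_eq_iff)
  ultimately show ?thesis unfolding x by blast
qed

lemma QI_val:
  assumes "x \<in> QI" "x \<noteq> 0"
  shows "\<exists>k. x \<in> gauss_val k"
proof -
  obtain a b c d where r: "Re x = of_int a / of_int b" "b > 0" and s: "Im x = of_int c / of_int d" "d > 0"
    using assms(1) by (auto simp: QI_def elim!: Rats_cases')
  have "x * of_int (b * d) = Complex (of_int (a * d)) (of_int (b * c))"
    using r s by (simp add: complex_eq_iff)
  then have "x * of_int (b * d) \<in> gauss_ints" by (simp add: gauss_ints_def)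
  moreover have nz: "(of_int (b * d) :: complex) \<noteq> 0" using r s by simp
  ultimately obtain m n where "x * of_int (b * d) \<in> gauss_val (int m)" "of_int (b * d) \<in> gauss_val (int n)"
    using gauss_ints_val assms(2) by (metis gauss_ints_closed(5) mult_eq_0_iff)
  from gauss_val_divide[OF this] nz show ?thesis by auto
qed

text \<open>If the real part is odd, expanding the square gives 1 plus 4 times a Gaussian integer
  that is even. If the imaginary part is odd, a factor \<open>\<i>\<close> reduces to that case and
  changes the sign.\<close>

lemma gauss_odd_square:
  assumes "\<alpha> \<in> gauss_odd"
  obtains s :: int and \<gamma> where "s = 1 \<or> s = - 1" "\<gamma> \<in> gauss_ints" "\<alpha>\<^sup>2 = of_int s + 4 * gpi * \<gamma>"
proof -
  have *: "\<exists>\<gamma> \<in> gauss_ints. (Complex (of_int c) (of_int d))\<^sup>2 = 1 + 4 * gpi * \<gamma>"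
    if "odd c" "even d" for c d
  proof -
    obtain e f where c: "c = 2 * e + 1" and d: "d = 2 * f"
      using \<open>odd c\<close> \<open>even d\<close> by (metis evenE oddE)
    \<comment> \<open>Both \<open>e^2 + e\<close> and \<open>f - f^2\<close> are even, which yields
      the extra factor \<open>gpi\<close> beyond 4.\<close>
    have "even ((e\<^sup>2 + e - f\<^sup>2) + (2 * e + 1) * f)" by auto
    then obtain u v where
      "Complex (of_int (e\<^sup>2 + e - f\<^sup>2)) (of_int ((2 * e + 1) * f)) = gpi * Complex (of_int u) (of_int v)"
      by (rule gauss_even)
    moreover have "(Complex (of_int c) (of_int d))\<^sup>2 =
        1 + 4 * Complex (of_int (e\<^sup>2 + e - f\<^sup>2)) (of_int ((2 * e + 1) * f))"
      by (simp add: c d complex_eq_iff power2_eq_square algebra_simps)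
    moreover have "Complex (of_int u) (of_int v) \<in> gauss_ints" by (simp add: gauss_ints_def)
    ultimately show ?thesis by (metis mult.assoc)
  qed
  obtain c d where \<alpha>: "\<alpha> = Complex (of_int c) (of_int d)" and "odd (c + d)"
    using assms by (auto simp: gauss_odd_def)
  show ?thesis
  proof (cases "odd c")
    case True
    with \<open>odd (c + d)\<close> have "even d" by simp
    then obtain \<gamma> where "\<gamma> \<in> gauss_ints" "\<alpha>\<^sup>2 = 1 + 4 * gpi * \<gamma>"
      using * True \<alpha> by blast
    then show ?thesis using that[of 1 \<gamma>] by simp
  next
    case False
    then have "odd d" "even (- c)" using \<open>odd (c + d)\<close> by auto
    then obtain \<gamma> where \<gamma>: "\<gamma> \<in> gauss_ints" "(Complex (of_int d) (of_int (- c)))\<^sup>2 = 1 + 4 * gpi * \<gamma>"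
      using * by blast
    have "\<alpha> = \<i> * Complex (of_int d) (of_int (- c))"
      by (simp add: \<alpha> complex_eq_iff)
    then have "\<alpha>\<^sup>2 = - ((Complex (of_int d) (of_int (- c)))\<^sup>2)"
      by (simp add: power_mult_distrib)
    then show ?thesis using that[of "- 1" "- \<gamma>"] \<gamma> by simp
  qed
qed

text \<open>The prime 2 ramifies: \<open>2 = -\<i> * gpi^2\<close>.\<close>

lemma gauss_val_2: "2 \<in> gauss_val 2"
proof -
  have "- \<i> \<in> gauss_odd"
    by (auto simp: gauss_odd_def complex_eq_iff intro!: exI[of _ 0] exI[of _ "- 1"])
  from gauss_val_gpi_power[OF this, of 2] show ?thesis
    by (simp add: gpi_def power2_eq_square algebra_simps)
qed

lemma gauss_val_4: "4 \<in> gauss_val 4"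
  using gauss_val_mult[OF gauss_val_2 gauss_val_2] by simp

text \<open>The square of a unit is \<open>\<plusminus>1\<close> modulo \<open>4(1 + \<i>)\<close>, while \<open>a\<close> is \<open>\<plusminus>3\<close> modulo 8; so one
  of \<open>x\<^sup>2 \<plusminus> a\<close> is exactly divisible by 2 and the other exactly by 4.\<close>

lemma gauss_val_square_diff:
  assumes a: "a mod 8 = 3 \<or> a mod 8 = (5::int)" and x: "x \<in> gauss_val 0"
  shows "x\<^sup>2 - of_int a \<in> gauss_val 2 \<and> x\<^sup>2 + of_int a \<in> gauss_val 4 \<or>
    x\<^sup>2 - of_int a \<in> gauss_val 4 \<and> x\<^sup>2 + of_int a \<in> gauss_val 2"
proof -
  obtain \<alpha> \<beta> where \<alpha>: "\<alpha> \<in> gauss_odd" and \<beta>: "\<beta> \<in> gauss_odd" and x_eq: "x = \<alpha> / \<beta>"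
    using x by (auto elim!: gauss_valE)
  obtain s :: int and \<gamma> where s: "s = 1 \<or> s = - 1"
    and \<gamma>: "\<gamma> \<in> gauss_ints" "\<alpha>\<^sup>2 = of_int s + 4 * gpi * \<gamma>"
    using gauss_odd_square[OF \<alpha>] .
  obtain t :: int and \<delta> where t: "t = 1 \<or> t = - 1"
    and \<delta>: "\<delta> \<in> gauss_ints" "\<beta>\<^sup>2 = of_int t + 4 * gpi * \<delta>"
    using gauss_odd_square[OF \<beta>] .
  have tt: "(of_int t :: complex) * of_int t = 1" using t by auto
  \<comment> \<open>Here \<open>b\<close> will be \<open>a\<close> or \<open>-a\<close>. Modulo
    \<open>4 * gpi\<close>, \<alpha>^2 - b \<beta>^2 is \<open>2 * s * (1 - 2 * h)\<close> and
    \<alpha>^2 + b \<beta>^2 is \<open>4 * h * s\<close>; as \<open>h\<close> and \<open>s\<close>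
    are odd, the valuations are 2 and 4.\<close>
  have main: "x\<^sup>2 - of_int b \<in> gauss_val 2 \<and> x\<^sup>2 + of_int b \<in> gauss_val 4"
    if b: "b = s * t * (4 * h - 1)" and "odd h" for b h
  proof -
    have \<beta>2: "\<beta>\<^sup>2 \<in> gauss_val 0" "\<beta>\<^sup>2 \<noteq> 0"
      using \<beta> gauss_val_odd[of "\<beta> * \<beta>"] by (auto simp: power2_eq_square)
    have b': "of_int b * (of_int t :: complex) = of_int s * (4 * of_int h - 1)"
      using tt unfolding b by (simp add: ac_simps)
    \<comment> \<open>The factor \<open>gpi * (1 - \<i>)\<close> is 2, written so that
      \<open>gauss_odd_add\<close> applies.\<close>
    have "of_int s + gpi * ((1 - \<i>) * (- of_int (h * s) + gpi * (\<gamma> - of_int b * \<delta>))) \<in> gauss_odd"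
      using s \<gamma>(1) \<delta>(1) by (intro gauss_odd_add) auto
    from gauss_val_mult[OF gauss_val_2 gauss_val_odd[OF this]]
    have "2 * (of_int s + gpi * ((1 - \<i>) * (- of_int (h * s) + gpi * (\<gamma> - of_int b * \<delta>)))) \<in> gauss_val 2"
      by simp
    also have "gpi * ((1 - \<i>) * (- of_int (h * s) + gpi * (\<gamma> - of_int b * \<delta>))) =
        2 * (- of_int (h * s) + gpi * (\<gamma> - of_int b * \<delta>))"
    proof -
      have "gpi * (1 - \<i>) = 2" by (simp add: gpi_def algebra_simps)
      then show ?thesis by (metis mult.assoc)
    qed
    also have "2 * (of_int s + 2 * (- of_int (h * s) + gpi * (\<gamma> - of_int b * \<delta>))) =
        \<alpha>\<^sup>2 - of_int b * \<beta>\<^sup>2"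
      using b' unfolding \<gamma>(2) \<delta>(2) of_int_mult by Groebner_Basis.algebra
    finally have 1: "\<alpha>\<^sup>2 - of_int b * \<beta>\<^sup>2 \<in> gauss_val 2" .
    have "of_int (h * s) + gpi * (\<gamma> + of_int b * \<delta>) \<in> gauss_odd"
      using s \<gamma>(1) \<delta>(1) \<open>odd h\<close> by (intro gauss_odd_add, unfold gauss_odd_of_int) auto
    from gauss_val_mult[OF gauss_val_4 gauss_val_odd[OF this]]
    have "4 * (of_int (h * s) + gpi * (\<gamma> + of_int b * \<delta>)) \<in> gauss_val 4" by simp
    also have "4 * (of_int (h * s) + gpi * (\<gamma> + of_int b * \<delta>)) = \<alpha>\<^sup>2 + of_int b * \<beta>\<^sup>2"
      using b' unfolding \<gamma>(2) \<delta>(2) of_int_mult by Groebner_Basis.algebra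
    finally have 2: "\<alpha>\<^sup>2 + of_int b * \<beta>\<^sup>2 \<in> gauss_val 4" .
    have "x\<^sup>2 - of_int b = (\<alpha>\<^sup>2 - of_int b * \<beta>\<^sup>2) / \<beta>\<^sup>2" "x\<^sup>2 + of_int b = (\<alpha>\<^sup>2 + of_int b * \<beta>\<^sup>2) / \<beta>\<^sup>2"
      using \<beta>2(2) by (simp_all add: x_eq power_divide diff_divide_distrib add_divide_distrib)
    then show ?thesis
      using gauss_val_divide[OF 1 \<beta>2(1)] gauss_val_divide[OF 2 \<beta>2(1)] by simp
  qed
  obtain h where h: "odd h" "a = 4 * h - 1 \<or> a = - (4 * h - 1)"
  proof (cases "a mod 8 = 3")
    case True
    then have "a = 4 * (2 * (a div 8) + 1) - 1" by presburger
    then show ?thesis using that[of "2 * (a div 8) + 1"] by simp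
  next
    case False
    with a have "a = - (4 * (- 2 * (a div 8) - 1) - 1)" by presburger
    then show ?thesis using that[of "- 2 * (a div 8) - 1"] by simp
  qed
  \<comment> \<open>Since \<open>s * t\<close> is 1 or -1, the sign can be moved to
    \<open>a\<close>; replacing \<open>a\<close> by \<open>-a\<close> exchanges the two alternatives
    of the claim.\<close>
  then have "a = s * t * (4 * h - 1) \<or> - a = s * t * (4 * h - 1)"
    using s t by auto
  then show ?thesis
  proof
    assume "a = s * t * (4 * h - 1)"
    from main[OF this h(1)] show ?thesis by simp
  next
    assume "- a = s * t * (4 * h - 1)"
    from main[OF this h(1)] show ?thesis by simp
  qed
qed

section \<open>Doubling decreases the valuation\<close>

text \<open>With \<open>i\<close> and \<open>j\<close> the valuations of \<open>x^2 - a\<close> and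
  \<open>x^2 + a\<close>, the duplication formula gives \<open>2i - 4 - k - j\<close> for the new
  abscissa.\<close>

lemma ec_double_val:
  assumes a: "a mod 8 = 3 \<or> a mod 8 = (5::int)"
    and P: "Some (x, y) \<in> ec_points (of_int a)" and x: "x \<in> gauss_val k"
  obtains x' y' k' where
    "ec_add (of_int a) (Some (x, y)) (Some (x, y)) = Some (x', y')" "x' \<in> gauss_val k'"
    "k < 0 \<Longrightarrow> k' = k - 4" "k > 0 \<Longrightarrow> k' < 0" "k = 0 \<Longrightarrow> k' \<noteq> 0"
proof -
  have "odd a" using a by presburger
  then have "of_int a \<in> gauss_odd" "of_int (- a) \<in> gauss_odd"
    unfolding gauss_odd_of_int by auto
  then have oa: "of_int a \<in> gauss_val 0" "- of_int a \<in> gauss_val 0"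
    using gauss_val_odd of_int_minus by metis+
  have xx: "x\<^sup>2 \<in> gauss_val (2 * k)"
    using gauss_val_mult[OF x x] by (simp add: power2_eq_square)
  obtain i j where i: "x\<^sup>2 - of_int a \<in> gauss_val i" and j: "x\<^sup>2 + of_int a \<in> gauss_val j"
    and neg: "k < 0 \<Longrightarrow> i = 2 * k \<and> j = 2 * k" and pos: "k > 0 \<Longrightarrow> i = 0 \<and> j = 0"
    and zero: "k = 0 \<Longrightarrow> i = 2 \<and> j = 4 \<or> i = 4 \<and> j = 2"
  proof (cases k "0 :: int" rule: linorder_cases)
    case less
    then show ?thesis
      using that[of "2 * k" "2 * k"] gauss_val_add_less[OF xx oa(1)] gauss_val_add_less[OF xx oa(2)] by simp
  next
    case equal
    then show ?thesis using that gauss_val_square_diff[OF a] x by blast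
  next
    case greater
    then show ?thesis
      using that[of 0 0] gauss_val_add_less[OF oa(1) xx] gauss_val_add_less[OF oa(2) xx]
      by (simp add: add.commute)
  qed
  have y2: "y\<^sup>2 = x * (x\<^sup>2 + of_int a)"
    using P by (simp add: power2_eq_square power3_eq_cube algebra_simps)
  \<comment> \<open>Both factors have a valuation, so \<open>y\<close> is nonzero and the doubling
    takes the tangent branch.\<close>
  moreover have "x \<noteq> 0" "x\<^sup>2 + of_int a \<noteq> 0" using x j by auto
  ultimately have y: "y \<noteq> 0" by auto
  define m where "m = (3 * x\<^sup>2 + of_int a) / (2 * y)"
  have m: "m * (2 * y) = 3 * x\<^sup>2 + of_int a" using y by (simp add: m_def)
  define x' where "x' = m\<^sup>2 - x - x"
  have "x' * (4 * (x * (x\<^sup>2 + of_int a))) = (x\<^sup>2 - of_int a)\<^sup>2"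
    using m y2 unfolding x'_def by Groebner_Basis.algebra
  then have x'_eq: "x' = (x\<^sup>2 - of_int a) * (x\<^sup>2 - of_int a) / (4 * (x * (x\<^sup>2 + of_int a)))"
    using \<open>x \<noteq> 0\<close> \<open>x\<^sup>2 + of_int a \<noteq> 0\<close> by (simp add: power2_eq_square eq_divide_eq)
  \<comment> \<open>This exponent is \<open>k - 4\<close> for \<open>k < 0\<close>, it is
    \<open>-4 - k\<close> for \<open>k > 0\<close>, and for \<open>k = 0\<close> it is -4 or
    2.\<close>
  have "x' \<in> gauss_val ((i + i) - (4 + (k + j)))"
    unfolding x'_eq by (intro gauss_val_divide gauss_val_mult gauss_val_4 x i j)
  moreover have "ec_add (of_int a) (Some (x, y)) (Some (x, y)) = Some (x', m * (x - x') - y)"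
    using y by (simp add: Let_def m_def x'_def)
  ultimately show ?thesis
    using neg pos zero that[of x' _ "(i + i) - (4 + (k + j))"] by fastforce
qed

lemma ec_not_torsion:
  assumes a: "a mod 8 = 3 \<or> a mod 8 = (5::int)"
    and P: "P \<in> ec_points (of_int a)" "P \<noteq> None" "P \<noteq> Some (0, 0)" and n: "n > 0"
  shows "P [^]\<^bsub>ec_group (of_int a)\<^esub> (n::nat) \<noteq> None"
proof
  assume torsion: "P [^]\<^bsub>ec_group (of_int a)\<^esub> n = None"
  define Q where "Q j = P [^]\<^bsub>ec_group (of_int a)\<^esub> (2 ^ j :: nat)" for j
  define V where "V j k \<longleftrightarrow> (\<exists>x y. Q j = Some (x, y) \<and> x \<in> gauss_val k)" for j k
  have "a \<noteq> 0" using a by auto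
  have step: "\<exists>k'. V (Suc j) k' \<and> (k < 0 \<longrightarrow> k' = k - 4) \<and> (k > 0 \<longrightarrow> k' < 0) \<and> (k = 0 \<longrightarrow> k' \<noteq> 0)"
    if jk: "V j k" for j k
  proof -
    obtain x y where xy: "Q j = Some (x, y)" "x \<in> gauss_val k" using jk by (auto simp: V_def)
    have "Q j \<in> ec_points (of_int a)" using P by (simp add: Q_def)
    moreover have "Q (Suc j) = ec_add (of_int a) (Q j) (Q j)"
      using ec_pow_double[of "of_int a" P "2 ^ j"] P \<open>a \<noteq> 0\<close> by (simp add: Q_def)
    ultimately show ?thesis
      using ec_double_val[OF a _ xy(2), of y] xy(1) unfolding V_def by (metis (no_types))
  qed
  obtain x y where xy: "P = Some (x, y)" using P(2) by auto
  then have "x \<noteq> 0" "x \<in> QI" using P by auto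
  then obtain k where "x \<in> gauss_val k" using QI_val by blast
  then have "V 0 k" by (simp add: V_def Q_def xy)
  \<comment> \<open>From valuation 0 the first doubling may reach a positive value, and the second
    then makes it negative; from any other value, one doubling already suffices and the next keeps
    the sign.\<close>
  then obtain k2 where k2: "V 2 k2" "k2 < 0"
  proof -
    obtain k1 where k1: "V 1 k1" "k < 0 \<longrightarrow> k1 < 0" "k > 0 \<longrightarrow> k1 < 0" "k = 0 \<longrightarrow> k1 \<noteq> 0"
      using step[OF \<open>V 0 k\<close>] by auto
    then have "k1 \<noteq> 0" by linarith
    moreover obtain k2 where "V (Suc 1) k2" "k1 < 0 \<longrightarrow> k2 < 0" "k1 > 0 \<longrightarrow> k2 < 0"
      using step[OF k1(1)] by auto
    ultimately show ?thesis using that[of k2] by (auto simp: numeral_2_eq_2)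
  qed
  have V: "V (2 + j) (k2 - 4 * int j)" for j
  proof (induction j)
    case (Suc j)
    then show ?case using step[of "2 + j" "k2 - 4 * int j"] k2(2) by (auto simp: algebra_simps)
  qed (use k2 in simp)
  have "inj (\<lambda>j. Q (2 + j))"
  proof (rule injI)
    fix i j assume "Q (2 + i) = Q (2 + j)"
    then have "k2 - 4 * int i = k2 - 4 * int j"
      using V[of i] V[of j] gauss_val_unique unfolding V_def by fastforce
    then show "i = j" by simp
  qed
  \<comment> \<open>Periodicity leaves at most \<open>n\<close> multiples of \<open>P\<close>,
    against the infinitely many distinct valuations.\<close>
  moreover have "range (\<lambda>j. Q (2 + j)) \<subseteq> (\<lambda>m. P [^]\<^bsub>ec_group (of_int a)\<^esub> m) ` {..<n}"
    using ec_pow_mod[OF torsion] n unfolding Q_def by (metis image_eqI image_subsetI lessThan_iff mod_less_divisor)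
  then have "finite (range (\<lambda>j. Q (2 + j)))" by (rule finite_subset) simp
  ultimately show False using finite_imageD infinite_UNIV_nat by blast
qed

section \<open>The torsion subgroup and the two curves\<close>

lemma ec_torsion_iso:
  assumes "a mod 8 = 3 \<or> a mod 8 = (5::int)"
  shows "ec_torsion (of_int a) \<cong> integer_mod_group 2"
proof -
  have "Some (0, 0) [^]\<^bsub>ec_group (of_int a)\<^esub> (2::nat) = None"
    by (simp add: numeral_2_eq_2)
  moreover have "None [^]\<^bsub>ec_group (of_int a)\<^esub> (1::nat) = None" by simp
  moreover have "P = None \<or> P = Some (0, 0)"
    if "P \<in> carrier (ec_torsion (of_int a))" for P
    using ec_not_torsion[OF assms, of P] that by (auto simp: ec_torsion_def simp del: not_None_eq)
  ultimately have carrier: "carrier (ec_torsion (of_int a)) = {None, Some (0, 0)}"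
    by (auto simp: ec_torsion_def intro: zero_less_numeral zero_less_one)
  have mult: "x \<otimes>\<^bsub>ec_torsion (of_int a)\<^esub> y = ec_add (of_int a) x y" for x y
    by (simp add: ec_torsion_def ec_group_def)
  have "(\<lambda>P. if P = None then 0 else 1) \<in> iso (ec_torsion (of_int a)) (integer_mod_group 2)"
    unfolding iso_def hom_def bij_betw_def inj_on_def
    by (auto simp: carrier mult carrier_integer_mod_group)
  then show ?thesis unfolding is_iso_def by blast
qed

theorem theorem1p3:
  fixes p q :: nat
  assumes "prime p" and "prime q"
    and "[p = 3] (mod 8)" and "[q = 1] (mod 8)"
    and "Legendre (int p) (int q) = -1"
  shows "ec_torsion (of_nat (p * q)) \<cong> integer_mod_group 2
       \<and> ec_torsion (- of_nat (p * q)) \<cong> integer_mod_group 2"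
proof -
  \<comment> \<open>The coefficients \<open>p * q\<close> and \<open>- (p * q)\<close> realise the
    two residues 3 and 5 allowed in \<open>ec_torsion_iso\<close>.\<close>
  have "[p * q = 3 * 1] (mod 8)" using assms by (intro cong_mult)
  then have "p * q mod 8 = 3" by (simp add: cong_def)
  then have "int (p * q) mod 8 = 3" by presburger
  moreover from this have "(- int (p * q)) mod 8 = 5" by presburger
  ultimately show ?thesis
    using ec_torsion_iso[of "int (p * q)"] ec_torsion_iso[of "- int (p * q)"] by simp
qed

end
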